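(* Let $\ell, r$ be integers with $0 < r < \ell$, and define $$C_{\ell,r} := \frac{1}{\pi^2} \int_0^{\pi} \int_0^{\pi} \sqrt{1 + \frac{r(\ell-r)\sin^2(s)}{\big[(\ell-r)\sin^2(t) + r\sin^2(s+t)\big]^2}} \, ds\, dt.$$ Then $C_{\ell,r} \in (\sqrt{2}, 2]$. *)

theory Defs
  imports "HOL-Analysis.Analysis"
begin

text \<open>
  The integrals are Lebesgue integrals, in the order written: \<open>s\<close> inside, \<open>t\<close> outside.
  The denominator vanishes only when \<open>sin t = 0\<close> and \<open>sin (s + t) = 0\<close>. For \<open>0 < t < pi\<close> it is
  therefore bounded away from \<open>0\<close> and the inner integrand is continuous in \<open>s\<close>. The endpoints
  \<open>t = 0\<close> and \<open>t = pi\<close>, where the inner integral diverges and so gets the value \<open>0\<close> by convention,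
  form a null set for the outer integral.
\<close>

definition C_const :: "int \<Rightarrow> int \<Rightarrow> real" where
  "C_const l r = 1 / pi\<^sup>2 *
     (LBINT t:{0..pi}. (LBINT s:{0..pi}.
        sqrt (1 + real_of_int r * (real_of_int l - real_of_int r) * (sin s)\<^sup>2 /
          ((real_of_int l - real_of_int r) * (sin t)\<^sup>2 + real_of_int r * (sin (s + t))\<^sup>2)\<^sup>2)))"

end

theory Submission
  imports Defs "HOL-Real_Asymp.Real_Asymp"
begin

text \<open>
  Put \<open>a = sqrt (l - r)\<close> and \<open>b = sqrt r\<close>. The integrand is \<open>sqrt (1 + F\<^sup>2)\<close> with
  \<open>F(s, t) = a b sin s / (a\<^sup>2 sin\<^sup>2 t + b\<^sup>2 sin\<^sup>2 (s + t))\<close>, and the point is that \<open>F\<close> has mean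
  exactly \<open>1\<close> over the square \<open>[0, pi]\<^sup>2\<close>, whatever \<open>a\<close> and \<open>b\<close> are. Indeed, for fixed
  \<open>0 < s < pi\<close> the substitution \<open>x = cot t\<close> turns \<open>F(s, t) dt\<close> into the differential of
  \<open>- arctan ((b / a) (x sin s + cos s))\<close>, and \<open>x\<close> runs from \<open>\<infinity>\<close> to \<open>-\<infinity>\<close>, so the integral
  over \<open>t\<close> is \<open>pi\<close> (\<open>ratio_integral\<close>). The integral in the theorem is taken over \<open>s\<close> first,
  so Fubini is needed to use this (\<open>ratio_integral_square\<close>).

  Both bounds now follow pointwise from
  \<open>(1 + y) / sqrt 2 \<le> sqrt (1 + y\<^sup>2) \<le> 1 + y\<close> for \<open>y \<ge> 0\<close>: the left side is the tangent line at
  the mean value \<open>1\<close>, as in Jensen's inequality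
  (\<open>integral_sqrt_one_plus_square_bounds\<close>). The tangent line is touched only at \<open>y = 1\<close>, and
  \<open>F < 1\<close> on a set of positive measure because \<open>F \<rightarrow> 0\<close> as \<open>s \<rightarrow> 0\<close> while \<open>t\<close> stays near
  \<open>pi / 2\<close> (\<open>ratio_not_AE_1\<close>); so the lower bound is strict.
\<close>

section \<open>The ratio and its integral over one period\<close>

definition ratio :: "real \<Rightarrow> real \<Rightarrow> real \<Rightarrow> real \<Rightarrow> real" where
  "ratio a b s t = a * b * sin s / (a\<^sup>2 * (sin t)\<^sup>2 + b\<^sup>2 * (sin (s + t))\<^sup>2)"

text \<open>
  By the addition formula, \<open>b sin (s + t) / (a sin t)\<close> is an affine function of \<open>cot t\<close>; dividing
  numerator and denominator of the ratio by \<open>a\<^sup>2 sin\<^sup>2 t\<close> makes the arctangent derivative visible.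
\<close>
lemma ratio_primitive:
  fixes a b s t :: real
  assumes "0 < a" "0 < b" and t: "sin t \<noteq> 0" and s: "sin s \<noteq> 0"
  shows "((\<lambda>t. - arctan (b / a * sin s * cot t + b / a * cos s)) has_real_derivative
     ratio a b s t) (at t)"
proof -
  have e: "b / a * sin s * cot t + b / a * cos s = b * sin (s + t) / (a * sin t)"
    using assms by (simp add: cot_def sin_add field_simps)
  have p: "a\<^sup>2 * (sin t)\<^sup>2 + b\<^sup>2 * (sin (s + t))\<^sup>2 > 0"
    using assms by (intro add_pos_nonneg) auto
  have "1 + (b * sin (s + t) / (a * sin t))\<^sup>2 =
      (a\<^sup>2 * (sin t)\<^sup>2 + b\<^sup>2 * (sin (s + t))\<^sup>2) / (a\<^sup>2 * (sin t)\<^sup>2)"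
    using assms by (simp add: field_simps)
  then have D: "- (inverse (1 + (b / a * sin s * cot t + b / a * cos s)\<^sup>2)
      * (b / a * sin s * - inverse ((sin t)\<^sup>2))) = ratio a b s t"
    unfolding e ratio_def using assms p by (simp add: field_simps power2_eq_square)
  have "((\<lambda>t. b / a * sin s * cot t + b / a * cos s) has_real_derivative
      b / a * sin s * - inverse ((sin t)\<^sup>2)) (at t)"
    using DERIV_add[OF DERIV_cmult[OF DERIV_cot[OF t], of "b / a * sin s"]
        DERIV_const[of "b / a * cos s"]] by simp
  from DERIV_minus[OF DERIV_chain2[OF DERIV_arctan this]] show ?thesis
    unfolding D .
qed

lemma arctan_cot_at_right_0:
  fixes c d :: real assumes "0 < c"
  shows "((\<lambda>t. arctan (c * cot t + d)) \<longlongrightarrow> pi / 2) (at_right 0)"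
  using assms unfolding cot_def by real_asymp

lemma arctan_cot_at_left_pi:
  fixes c d :: real assumes "0 < c"
  shows "((\<lambda>t. arctan (c * cot t + d)) \<longlongrightarrow> - (pi / 2)) (at_left pi)"
  using assms unfolding cot_def by real_asymp

abbreviation period :: "real measure" where
  "period \<equiv> restrict_space lborel {0..pi}"

lemma ratio_nonneg:
  assumes "0 < a" "0 < b" "s \<in> {0..pi}"
  shows "0 \<le> ratio a b s t"
  using assms by (auto simp: ratio_def intro!: divide_nonneg_nonneg mult_nonneg_nonneg sin_ge_zero)

text \<open>
  The primitive rises from \<open>- pi / 2\<close> to \<open>pi / 2\<close> on the open interval, independently of \<open>a\<close>, \<open>b\<close>
  and \<open>s\<close>. It has no continuous extension through \<open>0\<close> and \<open>pi\<close>, hence the version of the fundamental theorem of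
  calculus for nonnegative integrands and one-sided limits, which also yields integrability.
\<close>
lemma ratio_integral:
  fixes a b s :: real
  assumes "0 < a" "0 < b" and s: "0 < s" "s < pi"
  shows "integrable period (ratio a b s)" "(\<integral>t. ratio a b s t \<partial>period) = pi"
proof -
  have sins: "0 < sin s" using s by (rule sin_gt_zero)
  let ?G = "\<lambda>t. - arctan (b / a * sin s * cot t + b / a * cos s)"
  have c: "0 < b / a * sin s" using assms sins by simp
  have D: "DERIV ?G x :> ratio a b s x" if "0 < ereal x" "ereal x < ereal pi" for x
    using that sins sin_gt_zero[of x] assms by (intro ratio_primitive) auto
  have C: "isCont (ratio a b s) x" if "0 < ereal x" "ereal x < ereal pi" for x
  proof -
    have "0 < sin x" using that sin_gt_zero[of x] by auto
    then have "a\<^sup>2 * (sin x)\<^sup>2 + b\<^sup>2 * (sin (s + x))\<^sup>2 > 0"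
      using assms by (intro add_pos_nonneg) auto
    then show ?thesis unfolding ratio_def by (intro continuous_intros) auto
  qed
  have L: "((?G \<circ> real_of_ereal) \<longlongrightarrow> - (pi / 2)) (at_right 0)"
    unfolding zero_ereal_def ereal_tendsto_simps
    by (intro tendsto_minus arctan_cot_at_right_0 c)
  have R: "((?G \<circ> real_of_ereal) \<longlongrightarrow> - (- (pi / 2))) (at_left (ereal pi))"
    unfolding ereal_tendsto_simps
    by (intro tendsto_minus arctan_cot_at_left_pi c)
  have N: "AE x in lborel. 0 < ereal x \<longrightarrow> ereal x < ereal pi \<longrightarrow> 0 \<le> ratio a b s x"
    using ratio_nonneg assms s by auto
  note F = interval_integral_FTC_nonneg[OF _ D C N L R]
  have 1: "set_integrable lborel {0<..<pi} (ratio a b s)"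
    using F(1) by (simp add: einterval_eq zero_ereal_def)
  have 2: "(LBINT t=0..pi. ratio a b s t) = pi"
    using F(2) by simp
  have "set_integrable lborel {0..pi} (ratio a b s)"
    unfolding set_integrable_def
    using 1[unfolded set_integrable_def]
    by (subst integrable_discrete_difference[where X="{0,pi}"]) (auto simp: indicator_def)
  then show "integrable period (ratio a b s)"
    by (simp add: integrable_restrict_space set_integrable_def)
  show "(\<integral>t. ratio a b s t \<partial>period) = pi"
    using 2 interval_integral_Icc[of 0 pi "ratio a b s"]
    by (simp add: integral_restrict_space set_lebesgue_integral_def zero_ereal_def)
qed

section \<open>Mean one on a finite measure space\<close>

text \<open>
  The lower bound is Jensen's inequality for the convex function \<open>sqrt (1 + y\<^sup>2)\<close>, with its case of
  equality; the upper bound integrates \<open>sqrt (1 + y\<^sup>2) \<le> 1 + y\<close>.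
\<close>
lemma (in finite_measure) integral_sqrt_one_plus_square_bounds:
  fixes f :: "'a \<Rightarrow> real"
  assumes f: "integrable M f" and nonneg: "\<And>x. x \<in> space M \<Longrightarrow> 0 \<le> f x"
    and mean: "(\<integral>x. f x \<partial>M) = measure M (space M)"
    and nonconst: "\<not> (AE x in M. f x = 1)"
  shows "integrable M (\<lambda>x. sqrt (1 + (f x)\<^sup>2))"
    and "(\<integral>x. sqrt (1 + (f x)\<^sup>2) \<partial>M) \<in> {sqrt 2 * measure M (space M)<..2 * measure M (space M)}"
proof -
  have up: "sqrt (1 + y\<^sup>2) \<le> 1 + y" if "0 \<le> y" for y :: real
    using that by (intro real_le_lsqrt) (auto simp: power2_eq_square algebra_simps)
  have sq: "2 * (1 + y\<^sup>2) = (1 + y)\<^sup>2 + (1 - y)\<^sup>2" for y :: real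
    by (simp add: power2_eq_square algebra_simps)
  \<comment> \<open>The tangent line at \<open>y = 1\<close>; the defect is governed by the square \<open>(1 - y)\<^sup>2\<close> in \<open>sq\<close>.\<close>
  have lo: "(1 + y) / sqrt 2 \<le> sqrt (1 + y\<^sup>2)" for y :: real
  proof -
    have "1 + y \<le> sqrt (2 * (1 + y\<^sup>2))"
      by (rule real_le_rsqrt) (use sq[of y] in simp)
    then show ?thesis unfolding real_sqrt_mult by (simp add: field_simps)
  qed
  have eq: "y = 1" if "sqrt (1 + y\<^sup>2) = (1 + y) / sqrt 2" for y :: real
  proof -
    have "(sqrt (1 + y\<^sup>2))\<^sup>2 = ((1 + y) / sqrt 2)\<^sup>2" using that by simp
    then have "2 * (1 + y\<^sup>2) = (1 + y)\<^sup>2" by (simp add: power_divide)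
    then show ?thesis using sq[of y] by simp
  qed
  note [measurable] = borel_measurable_integrable[OF f]
  show int: "integrable M (\<lambda>x. sqrt (1 + (f x)\<^sup>2))"
    by (rule Bochner_Integration.integrable_bound[where f="\<lambda>x. 1 + f x"])
       (use f nonneg up in \<open>auto intro!: AE_I2\<close>)
  have "(\<integral>x. sqrt (1 + (f x)\<^sup>2) \<partial>M) \<le> (\<integral>x. 1 + f x \<partial>M)"
    using int f nonneg up by (intro integral_mono) auto
  then have U: "(\<integral>x. sqrt (1 + (f x)\<^sup>2) \<partial>M) \<le> 2 * measure M (space M)"
    using f mean by simp
  let ?d = "\<lambda>x. sqrt (1 + (f x)\<^sup>2) - (1 + f x) / sqrt 2"
  have d: "integrable M ?d" using int f by simp
  have "(\<integral>x. ?d x \<partial>M) \<noteq> 0"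
  proof
    assume "(\<integral>x. ?d x \<partial>M) = 0"
    then have "AE x in M. ?d x = 0"
      using integral_nonneg_eq_0_iff_AE[OF d] lo by auto
    then have "AE x in M. f x = 1"
      by eventually_elim (use eq in auto)
    then show False using nonconst by simp
  qed
  moreover have "(\<integral>x. ?d x \<partial>M) \<ge> 0"
    by (intro integral_nonneg_AE) (use lo in auto)
  ultimately have "0 < (\<integral>x. ?d x \<partial>M)" by simp
  also have "(\<integral>x. ?d x \<partial>M) = (\<integral>x. sqrt (1 + (f x)\<^sup>2) \<partial>M) - 2 / sqrt 2 * measure M (space M)"
    using int f mean by simp
  finally show "(\<integral>x. sqrt (1 + (f x)\<^sup>2) \<partial>M) \<in> {sqrt 2 * measure M (space M)<..2 * measure M (space M)}"
    using U by (simp only: real_div_sqrt) simp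
qed

section \<open>The ratio on the square\<close>

lemma finite_measure_period: "finite_measure period"
  by (rule finite_measureI) (simp add: space_restrict_space emeasure_restrict_space)

lemma sigma_finite_period: "sigma_finite_measure period"
  by (simp add: finite_measure.axioms(1) finite_measure_period)

lemma pair_sigma_finite_period: "pair_sigma_finite period period"
  by (simp add: pair_sigma_finite_def sigma_finite_period)

lemma measure_period_square:
  "measure (period \<Otimes>\<^sub>M period) (space (period \<Otimes>\<^sub>M period)) = pi\<^sup>2"
proof -
  interpret sigma_finite_measure period by (rule sigma_finite_period)
  have "emeasure (period \<Otimes>\<^sub>M period) (space (period \<Otimes>\<^sub>M period)) = ennreal pi * ennreal pi"
    unfolding space_pair_measure
    by (subst emeasure_pair_measure_Times)
       (auto simp: space_restrict_space emeasure_restrict_space sets_restrict_space)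
  then show ?thesis
    by (simp add: measure_def power2_eq_square enn2real_mult)
qed

text \<open>
  A nonempty open set is not negligible, so a property that holds almost everywhere holds
  somewhere in it.
\<close>
lemma AE_period_witness:
  assumes P: "AE x in period. P x" and "open U" "U \<inter> {0<..<pi} \<noteq> {}"
  shows "\<exists>x\<in>U \<inter> {0<..<pi}. P x"
proof (rule ccontr)
  assume no: "\<not> ?thesis"
  have "AE x in lborel. x \<in> {0..pi} \<longrightarrow> P x"
    using P by (subst (asm) AE_restrict_space_iff) auto
  then have "AE x in lborel. x \<notin> U \<inter> {0<..<pi}"
    by eventually_elim (use no in force)
  then have "AE x in lebesgue. x \<notin> U \<inter> {0<..<pi}"
    by (rule AE_completion)
  then have "negligible (U \<inter> {0<..<pi})"
    unfolding eventually_ae_filter_negligible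
    by (blast intro: negligible_subset)
  moreover have "open (U \<inter> {0<..<pi})" using assms by auto
  ultimately show False using assms open_not_negligible by blast
qed

lemma ratio_measurable [measurable]:
  "(\<lambda>x. ratio a b (fst x) (snd x)) \<in> borel_measurable (period \<Otimes>\<^sub>M period)"
proof -
  have [measurable]: "(\<lambda>x. x) \<in> period \<rightarrow>\<^sub>M borel"
    by (simp add: measurable_restrict_space1)
  show ?thesis unfolding ratio_def by measurable
qed

text \<open>
  If \<open>s < a / (2 b)\<close> and \<open>sin\<^sup>2 t > 1 / 2\<close>, the numerator is below \<open>a\<^sup>2 / 2\<close> and the first term of the
  denominator alone is above it.
\<close>
lemma ratio_not_AE_1:
  assumes "0 < a" "0 < b"
  shows "\<not> (AE x in period \<Otimes>\<^sub>M period. ratio a b (fst x) (snd x) = 1)"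
proof
  interpret pair_sigma_finite period period by (rule pair_sigma_finite_period)
  assume "AE x in period \<Otimes>\<^sub>M period. ratio a b (fst x) (snd x) = 1"
  from AE_pair[OF this] have "AE s in period. AE t in period. ratio a b s t = 1" by simp
  moreover have "{..<a / (2 * b)} \<inter> {0<..<pi} \<noteq> {}"
  proof -
    have "0 < min (a / (2 * b)) pi" using assms by simp
    from dense[OF this] show ?thesis by auto
  qed
  ultimately obtain s where s: "s < a / (2 * b)" "0 < s" "s < pi"
    and A: "AE t in period. ratio a b s t = 1"
    using AE_period_witness[of "\<lambda>s. AE t in period. ratio a b s t = 1" "{..<a / (2 * b)}"] by auto
  have "open {t::real. 1 / 2 < (sin t)\<^sup>2}" by (intro open_Collect_less continuous_intros)
  moreover have "pi / 2 \<in> {t::real. 1 / 2 < (sin t)\<^sup>2} \<inter> {0<..<pi}" by auto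
  ultimately obtain t where t: "1 / 2 < (sin t)\<^sup>2" and eq: "ratio a b s t = 1"
    using AE_period_witness[OF A] by blast
  have "a * b * sin s < a * b * (a / (2 * b))"
    using assms s sin_x_le_x[of s] by (intro mult_strict_left_mono) auto
  also have "\<dots> = a\<^sup>2 * (1 / 2)" using assms by (simp add: power2_eq_square)
  also have "\<dots> < a\<^sup>2 * (sin t)\<^sup>2" using assms t by (intro mult_strict_left_mono) auto
  also have "\<dots> \<le> a\<^sup>2 * (sin t)\<^sup>2 + b\<^sup>2 * (sin (s + t))\<^sup>2" by simp
  finally show False using eq unfolding ratio_def by (auto simp: divide_eq_1_iff)
qed

lemma ratio_integral_square:
  assumes "0 < a" "0 < b"
  shows "integrable (period \<Otimes>\<^sub>M period) (\<lambda>x. ratio a b (fst x) (snd x))"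
    and "(\<integral>x. ratio a b (fst x) (snd x) \<partial>(period \<Otimes>\<^sub>M period)) = pi\<^sup>2"
proof -
  interpret finite_measure period by (rule finite_measure_period)
  interpret pair_sigma_finite period period by (rule pair_sigma_finite_period)
  have sp: "space period = {0..pi}" by (simp add: space_restrict_space)
  have "AE s in lborel. s \<noteq> 0 \<and> s \<noteq> pi"
    using AE_lborel_singleton[of 0] AE_lborel_singleton[of pi] by eventually_elim auto
  then have AE: "AE s in period. 0 < s \<and> s < pi"
    by (subst AE_restrict_space_iff) auto
  have [measurable]: "(\<lambda>s. \<integral>t. ratio a b s t \<partial>period) \<in> borel_measurable period"
    using sigma_finite_measure.borel_measurable_lebesgue_integral
      [OF sigma_finite_period, of "ratio a b" period] ratio_measurable[of a b]
    by (simp add: case_prod_unfold)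
  have "has_bochner_integral period (\<lambda>s. pi) (pi\<^sup>2)"
    by (simp add: has_bochner_integral_iff measure_restrict_space space_restrict_space power2_eq_square)
  moreover have "AE s in period. (\<integral>t. ratio a b s t \<partial>period) = pi"
    using AE by eventually_elim (simp add: ratio_integral assms)
  ultimately have const: "has_bochner_integral period (\<lambda>s. \<integral>t. ratio a b s t \<partial>period) (pi\<^sup>2)"
    by (subst has_bochner_integral_cong_AE[where g="\<lambda>s. pi"]) auto
  \<comment> \<open>The ratio is nonnegative, so the iterated integral already computed is that of its norm.\<close>
  show int: "integrable (period \<Otimes>\<^sub>M period) (\<lambda>x. ratio a b (fst x) (snd x))"
  proof (rule Fubini_integrable)
    show "integrable period (\<lambda>s. \<integral>t. norm (ratio a b (fst (s, t)) (snd (s, t))) \<partial>period)"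
    proof (subst Bochner_Integration.integrable_cong[OF refl])
      show "(\<integral>t. norm (ratio a b (fst (s, t)) (snd (s, t))) \<partial>period) = (\<integral>t. ratio a b s t \<partial>period)"
        if "s \<in> space period" for s
        using that assms by (simp add: sp ratio_nonneg)
      show "integrable period (\<lambda>s. \<integral>t. ratio a b s t \<partial>period)"
        using const by (simp add: has_bochner_integral_iff)
    qed
  next
    show "AE s in period. integrable period (\<lambda>t. ratio a b (fst (s, t)) (snd (s, t)))"
      using AE by eventually_elim (simp add: ratio_integral assms)
  qed measurable
  show "(\<integral>x. ratio a b (fst x) (snd x) \<partial>(period \<Otimes>\<^sub>M period)) = pi\<^sup>2"
    using integral_fst[of "ratio a b"] int const
    by (simp add: case_prod_unfold has_bochner_integral_iff)
qed

section \<open>Bounds for the double integral\<close>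

theorem lemma2p2:
  fixes l r :: int
  assumes "0 < r" and "r < l"
  shows "C_const l r \<in> {sqrt 2<..2}"
proof -
  interpret pair_sigma_finite period period by (rule pair_sigma_finite_period)
  interpret P: finite_measure "period \<Otimes>\<^sub>M period"
    by (intro finite_measure_pair_measure finite_measure_period)
  define a b where "a = sqrt (real_of_int l - real_of_int r)" and "b = sqrt (real_of_int r)"
  have ab: "0 < a" "0 < b" and sq: "a\<^sup>2 = real_of_int l - real_of_int r" "b\<^sup>2 = real_of_int r"
    using assms by (auto simp: a_def b_def)
  let ?g = "\<lambda>s t. sqrt (1 + (ratio a b s t)\<^sup>2)"
  note bounds = P.integral_sqrt_one_plus_square_bounds
    [OF ratio_integral_square(1)[OF ab] _ _ ratio_not_AE_1[OF ab],
      unfolded measure_period_square, OF _ ratio_integral_square(2)[OF ab]]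
  have nn: "0 \<le> ratio a b (fst x) (snd x)" if "x \<in> space (period \<Otimes>\<^sub>M period)" for x
    using that ab by (intro ratio_nonneg) (auto simp: space_pair_measure space_restrict_space)
  have "C_const l r = 1 / pi\<^sup>2 * (\<integral>t. (\<integral>s. ?g s t \<partial>period) \<partial>period)"
    unfolding C_const_def set_lebesgue_integral_def ratio_def
    by (simp add: integral_restrict_space power_divide power_mult_distrib sq mult.commute)
  also have "(\<integral>t. (\<integral>s. ?g s t \<partial>period) \<partial>period) = (\<integral>x. ?g (fst x) (snd x) \<partial>(period \<Otimes>\<^sub>M period))"
    using integral_snd[of ?g] bounds(1)[OF nn] by (simp add: case_prod_unfold)
  finally show ?thesis
    using bounds(2)[OF nn] by (simp add: pos_less_divide_eq pos_divide_le_eq)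
qed

end
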